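(* Let $G$ be a starlike graph with vertex partition $C_1,\dots,C_k,D$, $|C_i|=n_i$, vertices ordered as $C_1,\dots,C_k,D$, and let $U = \operatorname{diag}\{U_{n_1},\dots,U_{n_k}, I_{|D|}\}$. Let $H$ be the graph whose adjacency matrix is $A(H) = Q(G)$ (respectively $A(H) = L(G)$), let $H^\pi$ be the graph with adjacency matrix $A(H^\pi) = U A(H) U$ (Seidel switching of $H$), and let $G'$ be a graph with $Q(G') = A(H^\pi)$ (respectively $L(G') = A(H^\pi)$). Then $G$ and $G'$ are $Q$-co-spectral (respectively $L$-co-spectral), i.e. $Q(G)$ and $Q(G')$ (respectively $L(G)$ and $L(G')$) have the same multiset of eigenvalues.
   Context: Graphs are weighted directed graphs with possible loops (of positive weight) and possibly two oppositely oriented edges between two vertices, with real weights. The adjacency matrix $A(G)=(a_{ij})$ has $a_{ij}=w(i,j)$ if $(i,j)$ is an edge (including loops) and $0$ otherwise. The degree matrix is $D(G)=\operatorname{diag}(d_1,\dots,d_N)$ with $d_i=\sum_j |a_{ij}|$; the Laplacian is $L(G)=D(G)-A(G)$ and the signless Laplacian is $Q(G)=D(G)+A(G)$. For $k\ge1$, $J_k$ is the $k\times k$ all-ones matrix, $I_k$ the identity, $U_k=\frac{2}{k}J_k-I_k$. A Seidel graph is a graph whose vertex set is partitioned into pairwise disjoint sets $C_1,\dots,C_k,D$ with $|C_i|=n_i\ge 2$, such that the subgraphs induced by each $C_i$ and by $D$ are regular; every $v\in D$ is adjacent to $0$, all $n_i$, or exactly $n_i/2$ vertices of $C_i$ for each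 $i$ (in the last case the edges from $v$ to these vertices have equal weights, and the edges from these vertices to $v$ have equal weights); and any two vertices joined by two directed edges are joined by oppositely oriented edges. For fixed $i$, a vertex of $D$ is of category 1 if adjacent to all vertices of $C_i$, category 2 if adjacent to exactly $n_i/2$ of them, category 3 if adjacent to none. A starlike graph is a Seidel graph such that: (1) there is no edge between a vertex of $C_i$ and a vertex of $C_j$ for $i\ne j$; (2) all edges from category 1 vertices of $D$ to $C_i$ have a common weight $w_+$, and all edges from $C_i$ to category 1 vertices have a common weight $w_-$; (3) the number of category 2 vertices of $D$ with respect to $C_i$ is even, half of them being adjacent to one set of $n_i/2$ vertices of $C_i$ and the other half to the complementary $n_i/2$ vertices; all edges from category 2 vertices to $C_i$ have a common weight $w^+$ and all edges from $C_i$ to category 2 vertices have a common weight $w^-$. *)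

theory Defs
  imports
    "Jordan_Normal_Form.Char_Poly"
    "Graph_Theory.Pair_Digraph"
    "Graph_Theory.Weighted_Graph"
begin

text \<open>
  A weighted graph is given by a finite digraph without parallel arcs and a weight function.
  The values of the weight function outside the arc set play no role.
\<close>

definition weighted_graph :: "'a pair_pre_digraph \<Rightarrow> ('a \<times> 'a) weight_fun \<Rightarrow> bool" where
  "weighted_graph G w \<longleftrightarrow>
     pair_fin_digraph G \<and> (\<forall>v. (v, v) \<in> parcs G \<longrightarrow> 0 < w (v, v))"

definition adj_entry :: "'a pair_pre_digraph \<Rightarrow> ('a \<times> 'a) weight_fun \<Rightarrow> 'a \<Rightarrow> 'a \<Rightarrow> real" where
  "adj_entry G w i j = (if (i, j) \<in> parcs G then w (i, j) else 0)"

definition wdegree :: "'a pair_pre_digraph \<Rightarrow> ('a \<times> 'a) weight_fun \<Rightarrow> 'a \<Rightarrow> real" where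
  "wdegree G w i = (\<Sum>j\<in>pverts G. \<bar>adj_entry G w i j\<bar>)"

definition regular_graph :: "'a pair_pre_digraph \<Rightarrow> ('a \<times> 'a) weight_fun \<Rightarrow> bool" where
  "regular_graph G w \<longleftrightarrow> (\<exists>r. \<forall>v\<in>pverts G. wdegree G w v = r)"

definition induced :: "'a pair_pre_digraph \<Rightarrow> 'a set \<Rightarrow> 'a pair_pre_digraph" where
  "induced G S = \<lparr> pverts = S, parcs = parcs G \<inter> S \<times> S \<rparr>"

definition adjacent :: "'a pair_pre_digraph \<Rightarrow> 'a \<Rightarrow> 'a \<Rightarrow> bool" where
  "adjacent G u v \<longleftrightarrow> (u, v) \<in> parcs G \<or> (v, u) \<in> parcs G"

definition nbrs_in :: "'a pair_pre_digraph \<Rightarrow> 'a \<Rightarrow> 'a set \<Rightarrow> 'a set" where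
  "nbrs_in G v C = {u \<in> C. adjacent G v u}"

text \<open>All arcs from \<open>S\<close> to \<open>T\<close> have a common weight.\<close>

definition common_weight ::
  "'a pair_pre_digraph \<Rightarrow> ('a \<times> 'a) weight_fun \<Rightarrow> 'a set \<Rightarrow> 'a set \<Rightarrow> bool" where
  "common_weight G w S T \<longleftrightarrow> (\<exists>c. \<forall>e \<in> parcs G \<inter> S \<times> T. w e = c)"

definition category1 :: "'a pair_pre_digraph \<Rightarrow> 'a set \<Rightarrow> 'a set \<Rightarrow> 'a set" where
  "category1 G D C = {v \<in> D. nbrs_in G v C = C}"

definition category2 :: "'a pair_pre_digraph \<Rightarrow> 'a set \<Rightarrow> 'a set \<Rightarrow> 'a set" where
  "category2 G D C = {v \<in> D. 2 * card (nbrs_in G v C) = card C}"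

definition category3 :: "'a pair_pre_digraph \<Rightarrow> 'a set \<Rightarrow> 'a set \<Rightarrow> 'a set" where
  "category3 G D C = {v \<in> D. nbrs_in G v C = {}}"

text \<open>
  The sets \<open>C\<^sub>1, \<dots>, C\<^sub>k\<close> form the list \<open>Cs\<close>.  The last condition of \<open>seidel_graph\<close>
  says that two distinct arcs joining the same two vertices are opposite to each other;
  for arcs represented as pairs it always holds.
\<close>

definition seidel_graph ::
  "'a pair_pre_digraph \<Rightarrow> ('a \<times> 'a) weight_fun \<Rightarrow> 'a set list \<Rightarrow> 'a set \<Rightarrow> bool" where
  "seidel_graph G w Cs D \<longleftrightarrow>
     weighted_graph G w \<and>
     pverts G = \<Union> (set Cs) \<union> D \<and>
     (\<forall>i < length Cs. \<forall>j < length Cs. i \<noteq> j \<longrightarrow> Cs ! i \<inter> Cs ! j = {}) \<and>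
     (\<forall>C \<in> set Cs. C \<inter> D = {} \<and> 2 \<le> card C) \<and>
     (\<forall>C \<in> set Cs. regular_graph (induced G C) w) \<and>
     regular_graph (induced G D) w \<and>
     (\<forall>C \<in> set Cs. D = category1 G D C \<union> category2 G D C \<union> category3 G D C) \<and>
     (\<forall>C \<in> set Cs. \<forall>v \<in> category2 G D C.
        common_weight G w {v} C \<and> common_weight G w C {v}) \<and>
     (\<forall>e \<in> parcs G. \<forall>e' \<in> parcs G.
        e \<noteq> e' \<and> {fst e, snd e} = {fst e', snd e'} \<longrightarrow> e' = prod.swap e)"

text \<open>
  In \<open>starlike_graph\<close>, if the category 2 set is nonempty then the set \<open>S\<close> is necessarily the
  neighbourhood of a category 2 vertex, so that it has \<open>card C / 2\<close> elements; if it is empty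
  then the condition on \<open>S\<close> is void.
\<close>

definition starlike_graph ::
  "'a pair_pre_digraph \<Rightarrow> ('a \<times> 'a) weight_fun \<Rightarrow> 'a set list \<Rightarrow> 'a set \<Rightarrow> bool" where
  "starlike_graph G w Cs D \<longleftrightarrow>
     seidel_graph G w Cs D \<and>
     (\<forall>i < length Cs. \<forall>j < length Cs. i \<noteq> j \<longrightarrow>
        (\<forall>u \<in> Cs ! i. \<forall>v \<in> Cs ! j. \<not> adjacent G u v)) \<and>
     (\<forall>C \<in> set Cs.
        common_weight G w (category1 G D C) C \<and>
        common_weight G w C (category1 G D C)) \<and>
     (\<forall>C \<in> set Cs.
        even (card (category2 G D C)) \<and>
        (\<exists>S \<subseteq> C.
           2 * card {v \<in> category2 G D C. nbrs_in G v C = S} = card (category2 G D C) \<and>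
           2 * card {v \<in> category2 G D C. nbrs_in G v C = C - S} = card (category2 G D C)) \<and>
        common_weight G w (category2 G D C) C \<and>
        common_weight G w C (category2 G D C))"

text \<open>
  Matrices are associated with weighted graphs on the vertex set \<open>{0, \<dots>, N - 1}\<close>.
\<close>

definition numbered_graph :: "nat pair_pre_digraph \<Rightarrow> (nat \<times> nat) weight_fun \<Rightarrow> bool" where
  "numbered_graph G w \<longleftrightarrow> weighted_graph G w \<and> pverts G = {..<card (pverts G)}"

definition ordered_blocks :: "nat set list \<Rightarrow> nat set \<Rightarrow> bool" where
  "ordered_blocks Cs D \<longleftrightarrow>
     (\<forall>j < length Cs. \<forall>i < j. \<forall>u \<in> Cs ! i. \<forall>v \<in> Cs ! j. u < v) \<and>
     (\<forall>C \<in> set Cs. \<forall>u \<in> C. \<forall>v \<in> D. u < v)"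

definition adjacency_matrix :: "nat pair_pre_digraph \<Rightarrow> (nat \<times> nat) weight_fun \<Rightarrow> real mat" where
  "adjacency_matrix G w = mat (card (pverts G)) (card (pverts G)) (\<lambda>(i, j). adj_entry G w i j)"

definition degree_matrix :: "nat pair_pre_digraph \<Rightarrow> (nat \<times> nat) weight_fun \<Rightarrow> real mat" where
  "degree_matrix G w = mat_diag (card (pverts G)) (wdegree G w)"

definition laplacian :: "nat pair_pre_digraph \<Rightarrow> (nat \<times> nat) weight_fun \<Rightarrow> real mat" where
  "laplacian G w = degree_matrix G w - adjacency_matrix G w"

definition signless_laplacian ::
  "nat pair_pre_digraph \<Rightarrow> (nat \<times> nat) weight_fun \<Rightarrow> real mat" where
  "signless_laplacian G w = degree_matrix G w + adjacency_matrix G w"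

definition J_mat :: "nat \<Rightarrow> real mat" where
  "J_mat k = mat k k (\<lambda>_. 1)"

definition U_mat :: "nat \<Rightarrow> real mat" where
  "U_mat k = (2 / real k) \<cdot>\<^sub>m J_mat k - 1\<^sub>m k"

definition switching_matrix :: "'a set list \<Rightarrow> 'a set \<Rightarrow> real mat" where
  "switching_matrix Cs D = diag_block_mat (map (\<lambda>C. U_mat (card C)) Cs @ [1\<^sub>m (card D)])"

text \<open>
  The complex eigenvalues of a real square matrix, counted with algebraic multiplicity.
\<close>

definition eigenvalue_mset :: "real mat \<Rightarrow> complex multiset" where
  "eigenvalue_mset A = proots (char_poly (map_mat complex_of_real A))"

definition L_cospectral where
  "L_cospectral G w G' w' \<longleftrightarrow>
     eigenvalue_mset (laplacian G w) = eigenvalue_mset (laplacian G' w')"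

definition Q_cospectral where
  "Q_cospectral G w G' w' \<longleftrightarrow>
     eigenvalue_mset (signless_laplacian G w) = eigenvalue_mset (signless_laplacian G' w')"

end

theory Submission
  imports Defs
begin

text \<open>
  Each block \<open>U\<^sub>k = (2/k) J\<^sub>k - I\<^sub>k\<close> is a reflection, because \<open>J\<^sub>k\<^sup>2 = k J\<^sub>k\<close>.  Hence
  \<open>U\<^sup>2 = I\<close>, the switching \<open>A \<mapsto> U A U\<close> is a similarity, and it preserves the
  characteristic polynomial.
\<close>

lemma dim_U_mat [simp]: "dim_row (U_mat k) = k" "dim_col (U_mat k) = k"
  by (simp_all add: U_mat_def J_mat_def)

lemma U_mat_involution:
  assumes "0 < k"
  shows "U_mat k * U_mat k = 1\<^sub>m k"
proof (rule eq_matI)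
  fix i j
  assume "i < dim_row (1\<^sub>m k :: real mat)" "j < dim_col (1\<^sub>m k :: real mat)"
  then have ij: "i < k" "j < k" by simp_all
  \<comment> \<open>With \<open>c\<close> and the Kronecker delta \<open>d\<close>, the block has
    entries \<open>c - d a b\<close>, so an entry of its square expands into four sums.\<close>
  define c where "c = 2 / real k"
  define d where "d = (\<lambda>a b :: nat. if a = b then 1 else 0 :: real)"
  have entry: "U_mat k $$ (a, b) = c - d a b" if "a < k" "b < k" for a b
    using that by (simp add: U_mat_def J_mat_def c_def d_def)
  have "(U_mat k * U_mat k) $$ (i, j) = (\<Sum>l\<in>{0..<k}. (c - d i l) * (c - d l j))"
    using ij by (auto simp: scalar_prod_def entry intro!: sum.cong)
  also have "\<dots> = (\<Sum>l\<in>{0..<k}. c * c - c * d i l - c * d l j + d i l * d l j)"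
    by (simp add: algebra_simps)
  also have "\<dots> = real k * (c * c) - c * (\<Sum>l\<in>{0..<k}. d i l) - c * (\<Sum>l\<in>{0..<k}. d l j)
      + (\<Sum>l\<in>{0..<k}. d i l * d l j)"
    by (simp add: sum.distrib sum_subtractf sum_distrib_left)
  also have "(\<Sum>l\<in>{0..<k}. d i l) = 1"
    using ij by (simp add: d_def)
  also have "(\<Sum>l\<in>{0..<k}. d l j) = 1"
    using ij by (simp add: d_def)
  \<comment> \<open>Only the term with \<open>l = i\<close> can survive in the product of
    deltas.\<close>
  also have "(\<Sum>l\<in>{0..<k}. d i l * d l j) = (\<Sum>l\<in>{0..<k}. if i = l then d i j else 0)"
    by (intro sum.cong) (auto simp: d_def)
  also have "\<dots> = d i j"
    using ij by simp
  \<comment> \<open>This is where the factor \<open>2 / k\<close> matters: the constant term cancels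
    against the two cross terms, leaving the delta.\<close>
  also have "real k * (c * c) = c + c"
    using assms by (simp add: c_def)
  finally show "(U_mat k * U_mat k) $$ (i, j) = 1\<^sub>m k $$ (i, j)"
    using ij by (simp add: d_def)
qed simp_all

text \<open>Powers of a block diagonal matrix with square blocks are taken block by block; the
  product is read as a second power to use this.\<close>

lemma diag_block_mat_involution:
  fixes As :: "'a :: semiring_1 mat list"
  assumes "\<forall>A \<in> set As. square_mat A \<and> A * A = 1\<^sub>m (dim_row A)"
  shows "diag_block_mat As * diag_block_mat As = 1\<^sub>m (sum_list (map dim_row As))"
proof -
  have square: "A ^\<^sub>m 2 = A * A" if "square_mat A" for A :: "'a mat"
    using that by (simp add: numeral_2_eq_2 left_mult_one_mat[of A "dim_row A" "dim_row A"])
  have sq: "Ball (set As) square_mat"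
    using assms by blast
  have "diag_block_mat As * diag_block_mat As = diag_block_mat As ^\<^sub>m 2"
    using square[OF diag_block_mat_square[OF sq]] by simp
  also have "\<dots> = diag_block_mat (map (\<lambda>A. A ^\<^sub>m 2) As)"
    by (rule diag_block_pow_mat[OF sq])
  also have "map (\<lambda>A. A ^\<^sub>m 2) As = map (\<lambda>A. 1\<^sub>m (dim_row A)) As"
    using assms square by (intro map_cong refl) metis
  finally show ?thesis by simp
qed

lemma switching_matrix_carrier:
  "switching_matrix Cs D \<in> carrier_mat (sum_list (map card Cs) + card D)
     (sum_list (map card Cs) + card D)"
  by (intro carrier_matI) (simp_all add: switching_matrix_def dim_diag_block_mat o_def)

lemma switching_matrix_involution:
  assumes "\<forall>C \<in> set Cs. 0 < card C"
  shows "switching_matrix Cs D * switching_matrix Cs D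
    = 1\<^sub>m (sum_list (map card Cs) + card D)"
proof -
  let ?Us = "map (\<lambda>C. U_mat (card C)) Cs @ [1\<^sub>m (card D)]"
  have "diag_block_mat ?Us * diag_block_mat ?Us = 1\<^sub>m (sum_list (map dim_row ?Us))"
    using assms by (intro diag_block_mat_involution) (auto simp: U_mat_involution)
  also have "sum_list (map dim_row ?Us) = sum_list (map card Cs) + card D"
    by (simp add: o_def)
  finally show ?thesis by (simp add: switching_matrix_def)
qed

text \<open>Disjointness is required for distinct positions, so no nonempty set is repeated in the
  list and nothing is counted twice in the sum.\<close>

lemma card_Union_disjoint_list:
  assumes "\<forall>i < length Cs. \<forall>j < length Cs. i \<noteq> j \<longrightarrow> Cs ! i \<inter> Cs ! j = {}"
    and "\<forall>C \<in> set Cs. finite C"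
  shows "card (\<Union> (set Cs)) = sum_list (map card Cs)"
  using assms
proof (induction Cs)
  case (Cons C Cs)
  have "\<forall>i < length Cs. \<forall>j < length Cs. i \<noteq> j \<longrightarrow> Cs ! i \<inter> Cs ! j = {}"
    using Cons.prems(1) by (metis Suc_less_eq length_Cons nat.inject nth_Cons_Suc)
  then have IH: "card (\<Union> (set Cs)) = sum_list (map card Cs)"
    using Cons by simp
  have "C \<inter> B = {}" if "B \<in> set Cs" for B
  proof -
    from that obtain j where "j < length Cs" "B = Cs ! j"
      by (metis in_set_conv_nth)
    then show ?thesis
      using Cons.prems(1)[rule_format, of 0 "Suc j"] by simp
  qed
  then have "C \<inter> \<Union> (set Cs) = {}" by blast
  then show ?case
    using IH Cons.prems(2) by (simp add: card_Un_disjoint)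
qed simp

text \<open>This matches the size of the switching matrix with that of the matrices of
  \<open>G\<close>.\<close>

lemma seidel_graph_card_verts:
  assumes "seidel_graph G w Cs D"
  shows "card (pverts G) = sum_list (map card Cs) + card D"
proof -
  have fin: "finite (pverts G)"
    using assms by (auto simp: seidel_graph_def weighted_graph_def
        pair_fin_digraph_def pair_fin_digraph_axioms_def)
  have verts: "pverts G = \<Union> (set Cs) \<union> D"
    and disj: "\<Union> (set Cs) \<inter> D = {}"
    using assms by (auto simp: seidel_graph_def)
  have "card (\<Union> (set Cs)) = sum_list (map card Cs)"
    using assms fin verts
    by (intro card_Union_disjoint_list) (auto simp: seidel_graph_def intro: finite_subset)
  then show ?thesis
    using fin disj by (simp add: verts card_Un_disjoint)
qed

text \<open>The switching matrix is its own inverse, so it serves as both transforming matrices of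
  the similarity. Its blocks are involutions because every cell has at least two elements.\<close>

lemma similar_mat_switching:
  assumes "seidel_graph G w Cs D"
    and "A \<in> carrier_mat (card (pverts G)) (card (pverts G))"
  shows "similar_mat (switching_matrix Cs D * A * switching_matrix Cs D) A"
proof -
  have "\<forall>C \<in> set Cs. 0 < card C"
    using assms(1) by (auto simp: seidel_graph_def)
  note involution = switching_matrix_involution[OF this]
  show ?thesis
    by (rule similar_matI[OF _ involution involution])
      (use switching_matrix_carrier[of Cs D] assms(2) seidel_graph_card_verts[OF assms(1)] in auto)
qed

text \<open>Similar real matrices have the same characteristic polynomial. Forming it commutes with
  the embedding into the complex numbers, so the complex roots agree with multiplicity.\<close>

lemma eigenvalue_mset_similar:
  assumes "similar_mat A B"
  shows "eigenvalue_mset A = eigenvalue_mset B"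
proof -
  obtain n where "A \<in> carrier_mat n n" "B \<in> carrier_mat n n"
    using similar_matD[OF assms] by auto
  then show ?thesis
    using char_poly_similar[OF assms]
    by (simp add: eigenvalue_mset_def of_real_hom.char_poly_hom)
qed

lemma laplacian_carrier:
  "laplacian G w \<in> carrier_mat (card (pverts G)) (card (pverts G))"
  by (intro carrier_matI) (simp_all add: laplacian_def adjacency_matrix_def)

lemma signless_laplacian_carrier:
  "signless_laplacian G w \<in> carrier_mat (card (pverts G)) (card (pverts G))"
  by (intro carrier_matI) (simp_all add: signless_laplacian_def adjacency_matrix_def)

theorem theorem2:
  fixes G :: "nat pair_pre_digraph" and w :: "(nat \<times> nat) weight_fun"
    and Cs :: "nat set list" and D :: "nat set"
  assumes "numbered_graph G w"
    and "starlike_graph G w Cs D"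
    and "ordered_blocks Cs D"
  shows "(\<forall>H wH H\<pi> w\<pi> G' w'.
            numbered_graph H wH \<longrightarrow> adjacency_matrix H wH = signless_laplacian G w \<longrightarrow>
            numbered_graph H\<pi> w\<pi> \<longrightarrow>
            adjacency_matrix H\<pi> w\<pi>
              = switching_matrix Cs D * adjacency_matrix H wH * switching_matrix Cs D \<longrightarrow>
            numbered_graph G' w' \<longrightarrow> signless_laplacian G' w' = adjacency_matrix H\<pi> w\<pi> \<longrightarrow>
            Q_cospectral G w G' w') \<and>
         (\<forall>H wH H\<pi> w\<pi> G' w'.
            numbered_graph H wH \<longrightarrow> adjacency_matrix H wH = laplacian G w \<longrightarrow>
            numbered_graph H\<pi> w\<pi> \<longrightarrow>
            adjacency_matrix H\<pi> w\<pi>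
              = switching_matrix Cs D * adjacency_matrix H wH * switching_matrix Cs D \<longrightarrow>
            numbered_graph G' w' \<longrightarrow> laplacian G' w' = adjacency_matrix H\<pi> w\<pi> \<longrightarrow>
            L_cospectral G w G' w')"
proof -
  have seidel: "seidel_graph G w Cs D"
    using assms(2) by (simp add: starlike_graph_def)
  \<comment> \<open>In both halves the hypotheses on \<open>H\<close>, \<open>H\<pi>\<close> and
    \<open>G'\<close> combine to say that the matrix of \<open>G'\<close> is \<open>U M U\<close>,
    with \<open>U\<close> the switching matrix and \<open>M\<close> the corresponding matrix of
    \<open>G\<close>. One rule therefore covers both.\<close>
  note similar = eigenvalue_mset_similar[OF similar_mat_switching[OF seidel]]
  show ?thesis
    by (simp add: Q_cospectral_def L_cospectral_def
        similar[OF signless_laplacian_carrier] similar[OF laplacian_carrier])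
qed

end
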